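(* Let $p$ be a prime number, let $d$ and $\ell$ be positive integers with $\ell \le d$, and let $1 \le s_1 < s_2 < \cdots < s_\ell = d$ be positive integers. For each $1 \le i \le \ell$ and each $j$ with $1 \le j \le s_i - 1$ and $j \ne s_1,\ldots,s_{i-1}$, let $a_{ij}$ be an integer with $1 \le a_{ij} \le p-1$. For $1 \le i \le \ell$ and $0 \le j \le d$ define $g_{ij} \in \mathbb{R}/\mathbb{Z}$ by $$g_{ij} = \begin{cases} -\sum_{k=1}^d g_{ik}, & \text{if } j = 0,\\ \frac{p-a_{ij}}{p}, & \text{if } 1 \le j \le s_i-1 \text{ and } j \ne s_1,\ldots,s_{i-1},\\ \frac1p, & \text{if } j = s_i,\\ 0, & \text{otherwise.}\end{cases}$$ Suppose that $r$ is an integer with $d = rp-1$, and that for each $1 \le j \le d-1$ with $j \ne s_1,\ldots,s_\ell$ there exists a positive integer $t_j$ such that $\sum_{i} a_{ij} = t_j p - 1$, where the sum is over all $i$ with $1\le i\le \ell$ and $s_i > j$. Let $\Delta \subset \mathbb{R}^d$ be a $d$-dimensional lattice simplex such that $\Lambda_\Delta$ is generated by $(g_{10},\ldots,g_{1d}),\ldots,(g_{\ell 0},\ldots,g_{\ell d})$ (such a $\Delta$ is Gorenstein of index $r$), and let $t$ be the unique interior lattice point of $r\Delta$. Then $$\mathrm{Vol}((r\Delta - t)^\vee) = r p^{d-\ell+1}.$$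
   Context: A lattice polytope is a convex polytope all of whose vertices have integer coordinates. $\mathrm{Vol}(\mathcal{P})$ denotes the normalized volume, i.e. $d!$ times the Euclidean volume of a $d$-dimensional lattice polytope $\mathcal{P}\subset\mathbb{R}^d$. For a $d$-dimensional lattice simplex $\Delta \subset \mathbb{R}^d$ with (ordered) vertices $v_0,\ldots,v_d \in \mathbb{Z}^d$, define the finite abelian group $$\Lambda_\Delta = \{(\lambda_0,\ldots,\lambda_d) \in (\mathbb{R}/\mathbb{Z})^{d+1} : \textstyle\sum_{i=0}^d \lambda_i (v_i,1) \in \mathbb{Z}^{d+1}\}$$ with componentwise addition. The dual polytope of $\mathcal{Q}\subset\mathbb{R}^d$ is $\mathcal{Q}^\vee = \{y \in \mathbb{R}^d : \langle x,y\rangle \le 1 \text{ for all } x \in \mathcal{Q}\}$. A $d$-dimensional lattice polytope $\mathcal{Q}$ is reflexive if the origin is the unique lattice point in its interior and $\mathcal{Q}^\vee$ is also a lattice polytope. A $d$-dimensional lattice polytope $\mathcal{P} \subset \mathbb{R}^d$ is Gorenstein of index $r$ ($r \in \mathbb{Z}_{>0}$) if there exist a reflexive polytope $\mathcal{Q} \subset \mathbb{R}^d$ and $w \in \mathbb{Z}^d$ with $\mathcal{Q} = r\mathcal{P} + w$; then $r\mathcal{P}$ has a unique interior lattice point $t$ and $\mathcal{Q} = r\mathcal{P} - t$. *)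

theory Defs
  imports
    "HOL-Analysis.Analysis"
    "HOL-Library.Real_Mod"
    "HOL-Library.Function_Algebras"
    "HOL-Computational_Algebra.Group_Closure"
begin

quotient_type rmodz = real / "\<lambda>x y. [x = y] (rmod 1)"
  morphisms rep_rmodz to_rmodz
  by (rule equivpI) (auto simp: reflp_def symp_def transp_def intro: rcong_sym rcong_trans)

instantiation rmodz :: ab_group_add
begin

lift_definition zero_rmodz :: rmodz is 0 .
lift_definition plus_rmodz :: "rmodz \<Rightarrow> rmodz \<Rightarrow> rmodz" is "(+)" by (rule rcong_add)
lift_definition minus_rmodz :: "rmodz \<Rightarrow> rmodz \<Rightarrow> rmodz" is "(-)" by (rule rcong_diff)
lift_definition uminus_rmodz :: "rmodz \<Rightarrow> rmodz" is uminus by (rule rcong_uminus)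

instance
  by standard (transfer, simp add: algebra_simps)+

end

definition int_lattice :: "(real ^ 'n) set" where
  "int_lattice = {x. \<forall>i. x $ i \<in> \<int>}"

definition lattice_polytope :: "(real ^ 'n) set \<Rightarrow> bool" where
  "lattice_polytope P \<longleftrightarrow> polytope P \<and> (\<forall>x. x extreme_point_of P \<longrightarrow> x \<in> int_lattice)"

definition full_dim_lattice_polytope :: "(real ^ 'n) set \<Rightarrow> bool" where
  "full_dim_lattice_polytope P \<longleftrightarrow> lattice_polytope P \<and> aff_dim P = int CARD('n)"

definition normalized_volume :: "(real ^ 'n) set \<Rightarrow> real" where
  "normalized_volume P = fact CARD('n) * measure lebesgue P"

definition dual_polytope :: "(real ^ 'n) set \<Rightarrow> (real ^ 'n) set" where
  "dual_polytope Q = {y. \<forall>x\<in>Q. x \<bullet> y \<le> 1}"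

definition reflexive_polytope :: "(real ^ 'n) set \<Rightarrow> bool" where
  "reflexive_polytope Q \<longleftrightarrow> full_dim_lattice_polytope Q \<and>
     interior Q \<inter> int_lattice = {0} \<and> lattice_polytope (dual_polytope Q)"

definition gorenstein_of_index :: "int \<Rightarrow> (real ^ 'n) set \<Rightarrow> bool" where
  "gorenstein_of_index r P \<longleftrightarrow> r > 0 \<and> full_dim_lattice_polytope P \<and>
     (\<exists>Q w. reflexive_polytope Q \<and> w \<in> int_lattice \<and> Q = (\<lambda>x. of_int r *\<^sub>R x + w) ` P)"

definition simplex_with_vertices ::
    "nat \<Rightarrow> (nat \<Rightarrow> real ^ 'n) \<Rightarrow> (real ^ 'n) set \<Rightarrow> bool" where
  "simplex_with_vertices d v \<Delta> \<longleftrightarrow>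
     int d simplex \<Delta> \<and> bij_betw v {0..d} {x. x extreme_point_of \<Delta>}"

text \<open>
  A \<open>(d+1)\<close>-tuple over the reals modulo the integers is a function on \<open>nat\<close> that
  vanishes beyond \<open>d\<close>, so that the group operation is pointwise addition of functions.
  When the \<open>v i\<close> are lattice points, the membership condition does not depend on the
  chosen representatives \<open>c\<close>.
\<close>

definition Lambda_group :: "nat \<Rightarrow> (nat \<Rightarrow> real ^ 'n) \<Rightarrow> (nat \<Rightarrow> rmodz) set" where
  "Lambda_group d v = {x. (\<forall>i>d. x i = 0) \<and>
     (\<exists>c. (\<forall>i\<le>d. x i = to_rmodz (c i)) \<and>
          (\<Sum>i=0..d. c i *\<^sub>R (v i, 1::real)) \<in> int_lattice \<times> \<int>)}"

definition gen_coord ::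
    "nat \<Rightarrow> (nat \<Rightarrow> nat) \<Rightarrow> (nat \<Rightarrow> nat \<Rightarrow> int) \<Rightarrow> nat \<Rightarrow> nat \<Rightarrow> rmodz" where
  "gen_coord p s a i j =
     (if 1 \<le> j \<and> j < s i \<and> j \<notin> s ` {1..<i}
        then to_rmodz ((real p - of_int (a i j)) / real p)
      else if j = s i then to_rmodz (1 / real p)
      else 0)"

definition gen ::
    "nat \<Rightarrow> nat \<Rightarrow> (nat \<Rightarrow> nat) \<Rightarrow> (nat \<Rightarrow> nat \<Rightarrow> int) \<Rightarrow> nat \<Rightarrow> nat \<Rightarrow> rmodz" where
  "gen p d s a i j =
     (if j = 0 then - (\<Sum>k=1..d. gen_coord p s a i k) else gen_coord p s a i j)"

end

theory Submission
  imports Defs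
begin

text \<open>
  The theorem is a computation in barycentric coordinates. Let \<open>u i\<close> be the linear part of the
  \<open>i\<close>-th barycentric coordinate of the simplex, so that the \<open>u i\<close> sum to zero and
  \<open>x = (\<Sum>i. (u i \<bullet> x) *\<^sub>R v i)\<close> for every \<open>x\<close> (\<open>affine_dual_basis\<close>). A combination of the vertices
  with integral coefficient sum is a lattice point iff its coefficients, taken modulo 1, lie in the
  group \<open>\<Lambda>\<close>; hence lattice questions about the simplex become questions about the generators.

  Two facts about the generated group make the simplex Gorenstein. Its elements have all coordinates
  in \<open>(1/p)\<int>\<close>, so \<open>w i = - p *\<^sub>R u i\<close> is a lattice vector. And it contains the constant tuple \<open>1/p\<close>,
  because modulo 1 this is the sum of the generators; so \<open>m = (1/p) *\<^sub>R (\<Sum>i. v i)\<close> is a lattice point.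
  Since \<open>r p = d + 1\<close>, the translate \<open>Q = r \<Delta> - m\<close> is cut out by the inequalities \<open>w i \<bullet> y \<le> 1\<close> and
  its dual is the simplex with vertices \<open>w i\<close>. A lattice point in the interior of \<open>Q\<close> has integers
  \<open>w i \<bullet> y \<le> 0\<close> with sum zero, so it is the origin.

  It remains to find the volume of the dual, which is \<open>p ^ d\<close> times the determinant of the
  vectors \<open>u i - u 0\<close> with \<open>i \<ge> 1\<close>. As \<open>u 0 = - (\<Sum>i\<ge>1. u i)\<close>, this determinant is that of the \<open>u i\<close> times the
  determinant \<open>d + 1 = r p\<close> of the identity plus the all-ones matrix (\<open>volume_dual\<close>). The determinant of the \<open>u i\<close>
  is \<open>\<plusminus>1/p ^ l\<close> (\<open>det_dual_basis\<close>), as one expects from the index of the lattice spanned by the edges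
  of \<open>\<Delta>\<close>: the generators are in echelon form with pivots in the columns \<open>s 1, \<dots>, s l\<close>, so membership
  of a point in the group amounts to integrality of \<open>p\<close> times each pivot coordinate and of each other
  coordinate after elimination (\<open>gen_group_iff\<close>). These conditions form a matrix of determinant
  \<open>\<plusminus>p ^ l\<close> whose product with the matrix of the \<open>u i\<close> maps precisely the lattice points to lattice
  points, hence is unimodular. Altogether the volume is \<open>p ^ d * (r p) / p ^ l\<close>.
\<close>

section \<open>The volume of a simplex in Cartesian space\<close>

text \<open>
  Transporting permutations along the bijection preserves their signs, so the two determinants agree
  term by term in the Leibniz expansion.
\<close>

lemma det_reindex:
  fixes A :: "'a::comm_ring_1 ^ 'n ^ 'n" and h :: "'m::finite \<Rightarrow> 'n::finite"
  assumes h: "bij h"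
  shows "det (\<chi> i j. A $ h i $ h j) = det A"
proof -
  have inj: "inj h" and surj: "surj h" using h by (auto simp: bij_def)
  have bij: "bij_betw (map_permutation UNIV h) {p. p permutes UNIV} {p. p permutes UNIV}"
  proof -
    have "map_permutation UNIV h = (\<lambda>p x. h (p (inv h x)))"
      using surj by (simp add: fun_eq_iff map_permutation_def restrict_id_def)
    then show ?thesis using bij_betw_permutations [OF h] by simp
  qed
  have "det A = (\<Sum>p | p permutes (UNIV :: 'm set).
      of_int (sign (map_permutation UNIV h p)) * (\<Prod>i\<in>UNIV. A $ i $ map_permutation UNIV h p i))"
    unfolding det_def
    by (rule sum.reindex_bij_betw [symmetric]) (rule bij)
  also have "\<dots> = (\<Sum>p | p permutes (UNIV :: 'm set). of_int (sign p) * (\<Prod>i\<in>UNIV. A $ h i $ h (p i)))"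
  proof (rule sum.cong [OF refl], clarify)
    fix p :: "'m \<Rightarrow> 'm" assume p: "p permutes UNIV"
    have "(\<Prod>i\<in>UNIV. A $ i $ map_permutation UNIV h p i) =
        (\<Prod>i\<in>UNIV. A $ h i $ map_permutation UNIV h p (h i))"
      by (rule prod.reindex_bij_betw [symmetric]) (rule h)
    then show "of_int (sign (map_permutation UNIV h p)) *
          (\<Prod>i\<in>UNIV. A $ i $ map_permutation UNIV h p i) =
        of_int (sign p) * (\<Prod>i\<in>UNIV. A $ h i $ h (p i))"
      using p inj by (simp add: sign_map_permutation map_permutation_apply)
  qed
  finally show ?thesis by (simp add: det_def)
qed

definition reindex_coords :: "('m \<Rightarrow> 'n) \<Rightarrow> real ^ 'n \<Rightarrow> real ^ 'm" where
  "reindex_coords h x = (\<chi> i. x $ h i)"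

lemma linear_reindex_coords: "linear (reindex_coords h)"
  by (rule linearI) (simp_all add: reindex_coords_def vec_eq_iff)

text \<open>
  Relabelling coordinates maps boxes to boxes with the same side lengths, and boxes determine
  Lebesgue measure.
\<close>

lemma lborel_reindex_coords:
  fixes h :: "'m::finite \<Rightarrow> 'n::finite"
  assumes h: "bij h"
  shows "lborel = distr lborel borel (reindex_coords h)"
proof (rule lborel_eqI)
  have cont: "continuous_on UNIV (reindex_coords h)"
    by (intro linear_continuous_on linear_reindex_coords linear_linear [THEN iffD2])
  have h': "h (inv h i) = i" for i using h by (simp add: bij_is_surj surj_f_inv_f)
  fix l u :: "real ^ 'm"
  assume le: "\<And>b. b \<in> Basis \<Longrightarrow> l \<bullet> b \<le> u \<bullet> b"
  let ?g = "reindex_coords (inv h)"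
  have le': "l $ i \<le> u $ i" for i using le [of "axis i 1"] by (simp add: inner_axis)
  have vimage: "reindex_coords h -` box l u = box (?g l) (?g u)"
  proof -
    have "(\<forall>j. P j (h j)) \<longleftrightarrow> (\<forall>i. P (inv h i) i)" for P
      using h' bij_inv_eq_iff [OF h] by metis
    from this [of "\<lambda>j i. l $ j < _ $ i \<and> _ $ i < u $ j"] show ?thesis
      by (simp add: set_eq_iff mem_box_cart reindex_coords_def)
  qed
  have "emeasure (distr lborel borel (reindex_coords h)) (box l u) = emeasure lborel (box (?g l) (?g u))"
    using cont by (subst emeasure_distr) (auto simp: vimage borel_measurable_continuous_onI)
  also have "\<dots> = ennreal (\<Prod>b\<in>Basis. (?g u - ?g l) \<bullet> b)"
    by (rule emeasure_lborel_box)
       (use le' in \<open>auto simp: Basis_vec_def inner_axis reindex_coords_def\<close>)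
  also have "(\<Prod>b\<in>Basis. (?g u - ?g l) \<bullet> b) = (\<Prod>b\<in>Basis. (u - l) \<bullet> b)"
  proof -
    have B: "(\<Prod>b\<in>Basis. w \<bullet> b) = (\<Prod>i\<in>UNIV. w $ i)" for w :: "real ^ 'k::finite"
    proof -
      have "(Basis :: (real ^ 'k) set) = (\<lambda>i. axis i 1) ` UNIV" by (auto simp: Basis_vec_def)
      moreover have "inj (\<lambda>i::'k. axis i (1::real))" by (auto simp: inj_on_def axis_eq_axis)
      ultimately show ?thesis by (intro prod.reindex_cong [of "\<lambda>i. axis i 1"]) (auto simp: inner_axis)
    qed
    have "(\<Prod>i\<in>UNIV. (u - l) $ inv h i) = (\<Prod>i\<in>UNIV. (u - l) $ i)"
      by (rule prod.reindex_bij_betw) (rule bij_imp_bij_inv [OF h])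
    then show ?thesis by (simp add: B reindex_coords_def)
  qed
  finally show "emeasure (distr lborel borel (reindex_coords h)) (box l u) =
      ennreal (\<Prod>b\<in>Basis. (u - l) \<bullet> b)" .
qed simp

text \<open>
  The formula \<open>content_simplex\<close> for the content of a simplex asks for a well-ordered index type.
  Copying an arbitrary finite type and numbering the copy provides one; both the content and
  the determinant are insensitive to the relabelling of the coordinates.
\<close>

typedef 'a wellordered = "UNIV :: 'a::finite set" ..

instantiation wellordered :: (finite) wellorder
begin

definition wellordered_index :: "'a wellordered \<Rightarrow> nat" where
  "wellordered_index x = (SOME f. inj f) (Rep_wellordered x)"
definition less_eq_wellordered :: "'a wellordered \<Rightarrow> 'a wellordered \<Rightarrow> bool" where
  "x \<le> y \<longleftrightarrow> wellordered_index x \<le> wellordered_index y"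
definition less_wellordered :: "'a wellordered \<Rightarrow> 'a wellordered \<Rightarrow> bool" where
  "x < y \<longleftrightarrow> wellordered_index x < wellordered_index y"

lemma inj_wellordered_index: "inj (wellordered_index :: 'a wellordered \<Rightarrow> nat)"
proof -
  have "\<exists>f :: 'a \<Rightarrow> nat. inj f"
    using finite_imp_inj_to_nat_seg [of "UNIV :: 'a set"] by blast
  then have "inj (SOME f :: 'a \<Rightarrow> nat. inj f)" by (rule someI_ex)
  then have "inj ((SOME f :: 'a \<Rightarrow> nat. inj f) \<circ> Rep_wellordered)"
    by (rule inj_compose) (rule injI, rule iffD1 [OF Rep_wellordered_inject])
  then show ?thesis by (simp only: o_def wellordered_index_def [abs_def])
qed

instance
proof
  fix x y z :: "'a wellordered"
  show "x \<le> y \<Longrightarrow> y \<le> x \<Longrightarrow> x = y"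
    unfolding less_eq_wellordered_def by (intro injD [OF inj_wellordered_index] antisym)
  fix P :: "'a wellordered \<Rightarrow> bool" and a
  assume step: "\<And>x. (\<And>y. y < x \<Longrightarrow> P y) \<Longrightarrow> P x"
  show "P a"
    by (induction a rule: measure_induct_rule [where f = wellordered_index])
       (rule step, simp add: less_wellordered_def)
qed (auto simp: less_eq_wellordered_def less_wellordered_def)

end

lemma bij_Rep_wellordered: "bij (Rep_wellordered :: 'a::finite wellordered \<Rightarrow> 'a)"
  using type_definition.Rep_range [OF type_definition_wellordered]
  by (simp add: bij_def inj_def Rep_wellordered_inject)

instance wellordered :: (finite) finite
  by standard (simp add: bij_betw_finite [OF bij_Rep_wellordered])

lemma content_simplex_finite:
  fixes X :: "(real ^ 'n) set" and f :: "'n \<Rightarrow> real ^ 'n"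
  assumes "finite X" and "card X = Suc CARD('n)" and "x0 \<in> X" and f: "bij_betw f UNIV (X - {x0})"
  shows "measure lborel (convex hull X) = \<bar>det (\<chi> i j. f j $ i - x0 $ i)\<bar> / fact CARD('n)"
proof -
  let ?h = "Rep_wellordered :: 'n wellordered \<Rightarrow> 'n"
  let ?\<phi> = "reindex_coords ?h"
  note h = bij_Rep_wellordered [where 'a = 'n]
  have inj: "inj ?\<phi>"
  proof (rule injI)
    fix x y assume "?\<phi> x = ?\<phi> y"
    then have "x $ ?h i = y $ ?h i" for i by (simp add: reindex_coords_def vec_eq_iff)
    then show "x = y" using bij_is_surj [OF h] by (metis vec_eq_iff surjD)
  qed
  have card: "CARD('n wellordered) = CARD('n)" using h by (rule bij_betw_same_card)
  have cont: "continuous_on UNIV ?\<phi>"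
    by (intro linear_continuous_on linear_reindex_coords linear_linear [THEN iffD2])
  have borel: "convex hull (?\<phi> ` X) \<in> sets borel"
    using assms(1) by (intro borel_compact finite_imp_compact_convex_hull) simp
  have "measure lborel (convex hull (?\<phi> ` X)) = measure lborel (?\<phi> -` (convex hull (?\<phi> ` X)))"
    using cont borel
    by (subst lborel_reindex_coords [OF h], subst measure_distr) (auto simp: borel_measurable_continuous_onI)
  also have "?\<phi> -` (convex hull (?\<phi> ` X)) = convex hull X"
    using convex_hull_linear_image [OF linear_reindex_coords, of ?h X] inj by (metis inj_vimage_image_eq)
  finally have eq: "measure lborel (convex hull X) = measure lborel (convex hull (?\<phi> ` X))" by simp
  have "bij_betw (?\<phi> \<circ> f \<circ> ?h) UNIV (?\<phi> ` (X - {x0}))"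
    using h f by (intro bij_betw_trans) (auto simp: inj_on_subset [OF inj] intro: inj_on_imp_bij_betw)
  also have "?\<phi> ` (X - {x0}) = ?\<phi> ` X - {?\<phi> x0}"
    using inj by (simp add: image_set_diff)
  finally have "measure lborel (convex hull (?\<phi> ` X)) =
      \<bar>det (\<chi> i j. (?\<phi> \<circ> f \<circ> ?h) j $ i - ?\<phi> x0 $ i)\<bar> / fact CARD('n wellordered)"
    using assms card card_image [OF inj_on_subset [OF inj, of X]]
    by (intro content_simplex) auto
  also have "(\<chi> i j. (?\<phi> \<circ> f \<circ> ?h) j $ i - ?\<phi> x0 $ i) = 
      (\<chi> i j. (\<chi> i j. f j $ i - x0 $ i) $ ?h i $ ?h j)"
    by (simp add: reindex_coords_def vec_eq_iff)
  finally show ?thesis using eq using det_reindex [OF h, of "\<chi> i j. f j $ i - x0 $ i"] by (simp add: card)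
qed

section \<open>Lattice points and unimodular matrices\<close>

lemma int_lattice_0: "0 \<in> int_lattice"
  by (simp add: int_lattice_def)

lemma int_lattice_add: "x \<in> int_lattice \<Longrightarrow> y \<in> int_lattice \<Longrightarrow> x + y \<in> int_lattice"
  by (simp add: int_lattice_def)

lemma int_lattice_diff: "x \<in> int_lattice \<Longrightarrow> y \<in> int_lattice \<Longrightarrow> x - y \<in> int_lattice"
  by (simp add: int_lattice_def)

lemma int_lattice_scaleR: "c \<in> \<int> \<Longrightarrow> x \<in> int_lattice \<Longrightarrow> c *\<^sub>R x \<in> int_lattice"
  by (simp add: int_lattice_def)

lemma int_lattice_sum: "(\<And>i. i \<in> A \<Longrightarrow> f i \<in> int_lattice) \<Longrightarrow> sum f A \<in> int_lattice"
  by (auto simp: int_lattice_def)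

lemma int_lattice_axis: "axis i (1::real) \<in> int_lattice"
  by (simp add: int_lattice_def axis_def)

lemma lattice_polytope_hull: "finite X \<Longrightarrow> X \<subseteq> int_lattice \<Longrightarrow> lattice_polytope (convex hull X)"
  unfolding lattice_polytope_def polytope_def using extreme_point_of_convex_hull by blast

lemma det_of_int_entries:
  fixes A :: "real ^ 'n ^ 'n"
  assumes "\<And>i j. A $ i $ j \<in> \<int>"
  shows "det A \<in> \<int>"
  unfolding det_def using assms by (intro Ints_sum Ints_mult Ints_prod) auto

lemma matrix_Ints_if_preserves:
  fixes A :: "real ^ 'n ^ 'n"
  assumes "\<And>x. x \<in> int_lattice \<Longrightarrow> A *v x \<in> int_lattice"
  shows "A $ i $ j \<in> \<int>"
proof -
  have "(A *v axis j 1) $ i \<in> \<int>"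
    using assms [OF int_lattice_axis] by (simp add: int_lattice_def)
  then show ?thesis by (simp add: matrix_vector_mult_basis column_def)
qed

text \<open>
  Both the matrix and its inverse have integral entries, so the determinant is a unit of \<open>\<int>\<close>.
\<close>

lemma det_lattice_automorphism:
  fixes A :: "real ^ 'n ^ 'n"
  assumes "invertible A" and iff: "\<And>x. A *v x \<in> int_lattice \<longleftrightarrow> x \<in> int_lattice"
  shows "\<bar>det A\<bar> = 1"
proof -
  obtain B where AB: "A ** B = mat 1"
    using assms(1) by (auto simp: invertible_def)
  have "B *v x \<in> int_lattice" if "x \<in> int_lattice" for x
    using that iff [of "B *v x"] by (simp add: matrix_vector_mul_assoc AB)
  then have "det A \<in> \<int>" "det B \<in> \<int>"
    using iff by (intro det_of_int_entries matrix_Ints_if_preserves; simp)+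
  then obtain m n where mn: "det A = of_int m" "det B = of_int n" by (auto elim!: Ints_cases)
  have "det A * det B = 1" using AB by (metis det_mul det_I)
  then have "m * n = 1" unfolding mn by (metis of_int_eq_1_iff of_int_mult)
  then show ?thesis unfolding mn using zmult_eq_1_iff by fastforce
qed

text \<open>
  The inverse of \<open>1 - N\<close> is \<open>1 + N\<close>. For the elimination matrix below this gives the determinant up to
  sign without having to order the index type so that the matrix becomes triangular.
\<close>

lemma det_one_minus_square_zero:
  fixes N :: "real ^ 'n ^ 'n"
  assumes int: "\<And>i j. N $ i $ j \<in> \<int>" and sq: "N ** N = 0"
  shows "\<bar>det (mat 1 - N)\<bar> = 1"
proof (rule det_lattice_automorphism)
  have inv: "(mat 1 - N) ** (mat 1 + N) = mat 1" "(mat 1 + N) ** (mat 1 - N) = mat 1"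
    using sq by (simp_all add: matrix_eq matrix_vector_mult_add_rdistrib matrix_vector_mult_diff_rdistrib
        matrix_vector_right_distrib matrix_vector_mult_diff_distrib flip: matrix_vector_mul_assoc)
  then show "invertible (mat 1 - N)" by (auto simp: invertible_def)
  have N: "N *v x \<in> int_lattice" if "x \<in> int_lattice" for x
    using that int by (auto simp: int_lattice_def matrix_vector_mult_def)
  show "(mat 1 - N) *v x \<in> int_lattice \<longleftrightarrow> x \<in> int_lattice" for x
  proof
    assume "(mat 1 - N) *v x \<in> int_lattice"
    then have "(mat 1 + N) *v ((mat 1 - N) *v x) \<in> int_lattice"
      unfolding matrix_vector_mult_add_rdistrib matrix_vector_mul_lid by (intro int_lattice_add N)
    then show "x \<in> int_lattice" by (simp add: matrix_vector_mul_assoc inv)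
  next
    assume "x \<in> int_lattice"
    then show "(mat 1 - N) *v x \<in> int_lattice"
      unfolding matrix_vector_mult_diff_rdistrib matrix_vector_mul_lid by (intro int_lattice_diff N)
  qed
qed

section \<open>The determinant of the identity plus the all-ones matrix\<close>

text \<open>
  By multilinearity, each row \<open>e i + 1\<close> splits into \<open>e i\<close> and the all-ones row. Choosing the all-ones row
  twice contributes zero, so that only the identity and the \<open>n\<close> identity matrices with one row replaced remain,
  each of determinant 1. The induction adds rows of the form \<open>e i + 1\<close> one at a time.
\<close>

lemma det_identity_plus_ones:
  "det (\<chi> i j. (if i = j then 1 else 0) + 1 :: real ^ 'n ^ 'n) = real CARD('n) + 1"
proof -
  let ?e = "\<lambda>i. axis i 1 :: real ^ 'n" and ?one = "\<chi> i. 1 :: real ^ 'n"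
  have replaced: "det (\<chi> i. if i = k then ?one else if i \<in> T then ?e i + ?one else ?e i) = 1" 
    if "k \<notin> T" for k and T :: "'n set"
    using finite [of T] that
  proof (induction T rule: finite_induct)
    case empty
    have "(\<Sum>i\<in>UNIV. ?one $ i *s row i (mat 1)) = ?one"
      by (simp add: vec_eq_iff row_def mat_def if_distrib cong: if_cong)
    moreover have "?e i = row i (mat 1)" for i
      by (simp add: vec_eq_iff row_def mat_def axis_def)
    ultimately show ?case 
      using cramer_lemma_transpose [of k ?one "mat 1 :: real ^ 'n ^ 'n"] by (simp only: empty_iff if_False) simp
  next
    case (insert m T)
    have "det (\<chi> i. if i = k then ?one else if i \<in> insert m T then ?e i + ?one else ?e i) = 
      det (\<chi> i. if i = m then ?e i + ?one else if i = k then ?one else if i \<in> T then ?e i + ?one else ?e i)"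
      using insert by (intro arg_cong [where f = det]) (auto simp: vec_eq_iff)
    also have "\<dots> = 
      det (\<chi> i. if i = m then ?e i else if i = k then ?one else if i \<in> T then ?e i + ?one else ?e i) + 
      det (\<chi> i. if i = m then ?one else if i = k then ?one else if i \<in> T then ?e i + ?one else ?e i)"
      by (rule det_row_add)
    also have "det (\<chi> i. if i = m then ?one else if i = k then ?one else if i \<in> T then ?e i + ?one else ?e i) = 0"
      using insert by (intro det_identical_rows [of m k]) (auto simp: row_def vec_eq_iff)
    also have "(\<chi> i. if i = m then ?e i else if i = k then ?one else if i \<in> T then ?e i + ?one else ?e i) =
        (\<chi> i. if i = k then ?one else if i \<in> T then ?e i + ?one else ?e i)"
      using insert by (auto simp: vec_eq_iff)
    finally show ?case using insert by simp
  qed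
  have "det (\<chi> i. if i \<in> T then ?e i + ?one else ?e i) = 1 + real (card T)" for T :: "'n set"
    using finite [of T]
  proof (induction T rule: finite_induct)
    case empty
    have "(\<chi> i. ?e i) = mat 1"
      by (simp add: vec_eq_iff axis_def mat_def)
    then show ?case by simp
  next
    case (insert m T)
    have "det (\<chi> i. if i \<in> insert m T then ?e i + ?one else ?e i) = 
      det (\<chi> i. if i = m then ?e i + ?one else if i \<in> T then ?e i + ?one else ?e i)"
      using insert by (intro arg_cong [where f = det]) (auto simp: vec_eq_iff)
    also have "\<dots> = 
      det (\<chi> i. if i = m then ?e i else if i \<in> T then ?e i + ?one else ?e i) + 
      det (\<chi> i. if i = m then ?one else if i \<in> T then ?e i + ?one else ?e i)"
      by (rule det_row_add)
    also have "(\<chi> i. if i = m then ?e i else if i \<in> T then ?e i + ?one else ?e i) =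
        (\<chi> i. if i \<in> T then ?e i + ?one else ?e i)"
      using insert by (auto simp: vec_eq_iff)
    finally show ?case using insert replaced [of m T] by simp
  qed
  from this [of UNIV] have "det (\<chi> i. ?e i + ?one) = real CARD('n) + 1" by simp
  moreover have "(\<chi> i. ?e i + ?one) = (\<chi> i j. (if i = j then 1 else 0) + 1 :: real ^ 'n ^ 'n)"
    by (auto simp: vec_eq_iff axis_def)
  ultimately show ?thesis by simp
qed

section \<open>Points of the torus and the group of a simplex\<close>

lemma to_rmodz_eq_iff: "to_rmodz x = to_rmodz y \<longleftrightarrow> x - y \<in> \<int>"
proof -
  have "to_rmodz x = to_rmodz y \<longleftrightarrow> (\<exists>n. y = x + of_int n)"
    by (simp add: rmodz.abs_eq_iff rcong_altdef)
  also have "\<dots> \<longleftrightarrow> y - x \<in> \<int>"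
    by (auto elim!: Ints_cases simp: algebra_simps)
  also have "\<dots> \<longleftrightarrow> x - y \<in> \<int>"
    by (metis Ints_minus minus_diff_eq)
  finally show ?thesis .
qed

lemma to_rmodz_sum: "to_rmodz (sum f A) = (\<Sum>k\<in>A. to_rmodz (f k))"
  by (induction A rule: infinite_finite_induct) (simp_all flip: zero_rmodz_def plus_rmodz.abs_eq)

text \<open>
  Extending by zero beyond \<open>d\<close> matches the encoding of tuples in \<open>Lambda_group\<close>, so that the elements of the
  group are exactly of this form and can be handled through real representatives.
\<close>

definition torus_point :: "nat \<Rightarrow> (nat \<Rightarrow> real) \<Rightarrow> nat \<Rightarrow> rmodz" where
  "torus_point d c = (\<lambda>k. if k \<le> d then to_rmodz (c k) else 0)"

lemma torus_point_eq_iff: "torus_point d c = torus_point d c' \<longleftrightarrow> (\<forall>k\<le>d. c k - c' k \<in> \<int>)"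
  by (auto simp: torus_point_def fun_eq_iff to_rmodz_eq_iff)

lemma torus_point_0: "torus_point d (\<lambda>_. 0) = 0"
  by (simp add: torus_point_def fun_eq_iff zero_rmodz_def)

lemma torus_point_add: "torus_point d (\<lambda>k. c k + c' k) = torus_point d c + torus_point d c'"
  by (simp add: torus_point_def fun_eq_iff plus_rmodz.abs_eq)

lemma torus_point_diff: "torus_point d (\<lambda>k. c k - c' k) = torus_point d c - torus_point d c'"
  by (simp add: torus_point_def fun_eq_iff minus_rmodz.abs_eq)

lemma torus_point_minus: "torus_point d (\<lambda>k. - c k) = - torus_point d c"
  using torus_point_diff [of d "\<lambda>_. 0" c] by (simp add: torus_point_0)

lemma torus_point_of_int_mult_in_group_closure:
  assumes c: "torus_point d c \<in> group_closure S"
  shows "torus_point d (\<lambda>k. of_int n * c k) \<in> group_closure S"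
proof -
  have nat: "torus_point d (\<lambda>k. of_nat m * c k) \<in> group_closure S" for m
  proof (induction m)
    case 0
    show ?case by (simp only: of_nat_0 mult_zero_left torus_point_0 zero_in_group_closure)
  next
    case (Suc m)
    from group_closure_add [OF c this] show ?case
      by (simp only: of_nat_Suc distrib_right mult_1 torus_point_add)
  qed
  show ?thesis
  proof (cases n rule: int_cases2)
    case (nonneg m)
    with nat [of m] show ?thesis by simp
  next
    case (nonpos m)
    with nat [of m] show ?thesis
      by (simp only: of_int_minus of_int_of_nat_eq mult_minus_left torus_point_minus group_closure_minus_iff)
  qed
qed

lemma torus_point_in_group_closure_iff:
  fixes g :: "'i \<Rightarrow> nat \<Rightarrow> real"
  assumes fin: "finite I"
  shows "torus_point d c \<in> group_closure ((\<lambda>i. torus_point d (g i)) ` I) \<longleftrightarrow>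
    (\<exists>n::'i \<Rightarrow> int. \<forall>k\<le>d. c k - (\<Sum>i\<in>I. of_int (n i) * g i k) \<in> \<int>)"
    (is "?lhs \<longleftrightarrow> ?rhs")
proof -
  define T where "T = group_closure ((\<lambda>i. torus_point d (g i)) ` I)"
  define comb :: "('i \<Rightarrow> int) \<Rightarrow> 'i set \<Rightarrow> nat \<Rightarrow> rmodz"
    where "comb n J = torus_point d (\<lambda>k. \<Sum>i\<in>J. of_int (n i) * g i k)" for n J
  have comb_0: "comb (\<lambda>_. 0) I = 0"
    by (simp only: comb_def of_int_0 mult_zero_left sum.neutral_const torus_point_0)
  have comb_single: "comb (\<lambda>i. if i = j then 1 else 0) I = torus_point d (g j)" if "j \<in> I" for j
  proof -
    have "(\<Sum>i\<in>I. of_int (if i = j then 1 else 0) * g i k) = g j k" for k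
      using fin that by (simp add: if_distrib [where f = "\<lambda>z. of_int z * _"] cong: if_cong)
    then show ?thesis by (simp only: comb_def)
  qed
  have comb_diff: "comb n I - comb m I = comb (\<lambda>i. n i - m i) I" for n m
    by (simp only: comb_def of_int_diff left_diff_distrib sum_subtractf torus_point_diff)
  have "\<exists>n. x = comb n I" if "x \<in> T" for x
    using that unfolding T_def
  proof (induction rule: group_closure.induct)
    case (base x)
    then show ?case using comb_0 [symmetric] comb_single [symmetric] by blast
  next
    case (diff x y)
    then obtain n m where "x = comb n I" "y = comb m I" by blast
    then show ?case using comb_diff [of n m] by (intro exI [of _ "\<lambda>i. n i - m i"]) (simp only:)
  qed
  moreover have "comb n J \<in> T" if "J \<subseteq> I" for n J
    using finite_subset [OF that fin] that
  proof (induction J rule: finite_induct)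
    case empty
    show ?case by (simp only: T_def comb_def sum.empty torus_point_0 zero_in_group_closure)
  next
    case (insert j J)
    have "torus_point d (g j) \<in> T"
      using insert.prems unfolding T_def by (intro group_closure.base) blast
    then have "torus_point d (\<lambda>k. of_int (n j) * g j k) \<in> T"
      unfolding T_def by (rule torus_point_of_int_mult_in_group_closure)
    moreover have "comb n J \<in> T" using insert by blast
    moreover have "comb n (insert j J) = torus_point d (\<lambda>k. of_int (n j) * g j k) + comb n J"
      using insert.hyps by (simp only: comb_def sum.insert torus_point_add not_False_eq_True)
    ultimately show ?case unfolding T_def by (simp only: group_closure_add)
  qed
  ultimately have "torus_point d c \<in> T \<longleftrightarrow> (\<exists>n. torus_point d c = comb n I)"
    by (metis subset_refl)
  then show ?thesis by (simp only: T_def comb_def torus_point_eq_iff)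
qed

text \<open>
  Changing a representative by an integer adds a lattice vector to the combination of the
  vertices and an integer to the coefficient sum, so any one representative decides membership.
\<close>

lemma torus_point_in_Lambda_group_iff:
  assumes v: "\<And>i. i \<le> d \<Longrightarrow> v i \<in> int_lattice"
  shows "torus_point d c \<in> Lambda_group d v \<longleftrightarrow>
    (\<Sum>i\<le>d. c i *\<^sub>R v i) \<in> int_lattice \<and> (\<Sum>i\<le>d. c i) \<in> \<int>"
proof
  have split: "(\<Sum>i\<le>d. b i *\<^sub>R (v i, 1)) = (\<Sum>i\<le>d. b i *\<^sub>R v i, \<Sum>i\<le>d. b i)" for b :: "nat \<Rightarrow> real"
    by (simp add: sum_prod)
  show "(\<Sum>i\<le>d. c i *\<^sub>R v i) \<in> int_lattice \<and> (\<Sum>i\<le>d. c i) \<in> \<int> \<Longrightarrow> torus_point d c \<in> Lambda_group d v"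
    unfolding Lambda_group_def unfolding atLeast0AtMost split
    by (auto simp: torus_point_def intro!: exI [of _ c])
  assume "torus_point d c \<in> Lambda_group d v"
  then obtain b where b: "\<And>i. i \<le> d \<Longrightarrow> c i - b i \<in> \<int>"
      and *: "(\<Sum>i\<le>d. b i *\<^sub>R v i) \<in> int_lattice" "(\<Sum>i\<le>d. b i) \<in> \<int>"
    unfolding Lambda_group_def atLeast0AtMost split
    by (auto simp: torus_point_def to_rmodz_eq_iff)
  have "(\<Sum>i\<le>d. c i *\<^sub>R v i) = (\<Sum>i\<le>d. b i *\<^sub>R v i) + (\<Sum>i\<le>d. (c i - b i) *\<^sub>R v i)"
    by (simp add: scaleR_diff_left sum_subtractf)
  moreover have "(\<Sum>i\<le>d. c i) = (\<Sum>i\<le>d. b i) + (\<Sum>i\<le>d. c i - b i)"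
    by (simp add: sum_subtractf)
  ultimately show "(\<Sum>i\<le>d. c i *\<^sub>R v i) \<in> int_lattice \<and> (\<Sum>i\<le>d. c i) \<in> \<int>"
    using * b v by (auto intro!: int_lattice_add int_lattice_sum int_lattice_scaleR Ints_add)
qed

section \<open>The group generated by the given tuples\<close>

text \<open>
  The numbers \<open>s 1 < \<dots> < s l = d\<close> are the pivot columns of the generators.
\<close>

locale generator_data =
  fixes p d l :: nat and s :: "nat \<Rightarrow> nat" and a :: "nat \<Rightarrow> nat \<Rightarrow> int"
  assumes p_pos: "p > 0"
    and l_pos: "l > 0" and s_1: "1 \<le> s 1" and mono: "strict_mono_on {1..l} s" and s_l: "s l = d"
begin

definition S :: "nat set" where "S = s ` {1..l}"

text \<open>
  The numerators, modulo \<open>p\<close>, of the generators in columns \<open>j \<ge> 1\<close>: the entry \<open>(p - a i j) / p\<close> is replaced by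
  the congruent \<open>- a i j / p\<close>.
\<close>

definition num :: "nat \<Rightarrow> nat \<Rightarrow> int" where
  "num i j = (if 1 \<le> j \<and> j < s i \<and> j \<notin> s ` {1..<i} then - a i j else if j = s i then 1 else 0)"

definition lift_gen :: "nat \<Rightarrow> nat \<Rightarrow> real" where
  "lift_gen i j = (if j = 0 then - (\<Sum>k=1..d. of_int (num i k) / p) else of_int (num i j) / p)"

lemma s_bounds:
  assumes "i \<in> {1..l}"
  shows "1 \<le> s i" "s i \<le> d"
  using strict_mono_on_leD [OF mono, of 1 i] strict_mono_on_leD [OF mono, of i l] assms s_1 s_l by auto

lemma inj_s: "inj_on s {1..l}"
  using mono by (rule strict_mono_on_imp_inj_on)

text \<open>
  The generators are in reduced echelon form: each one vanishes in the pivot columns of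
  the others, in earlier ones by construction and in later ones because its support ends at its own pivot.
\<close>

lemma num_s:
  assumes "i \<in> {1..l}" "k \<in> {1..l}"
  shows "num i (s k) = (if i = k then 1 else 0)"
proof (cases i k rule: linorder_cases)
  case less
  have "s i < s k" by (rule strict_mono_onD [OF mono assms less])
  with less show ?thesis by (simp add: num_def)
next
  case equal
  then show ?thesis by (simp add: num_def)
next
  case greater
  have "s k < s i" by (rule strict_mono_onD [OF mono assms(2,1) greater])
  moreover have "s k \<in> s ` {1..<i}" using greater assms by auto
  ultimately show ?thesis using greater by (simp add: num_def)
qed

lemma gen_eq_torus_point:
  assumes i: "i \<in> {1..l}"
  shows "gen p d s a i = torus_point d (lift_gen i)"
proof
  fix j
  have coord: "gen_coord p s a i k = to_rmodz (of_int (num i k) / p)" for k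
  proof -
    have "(real p - of_int (a i k)) / p - - of_int (a i k) / p \<in> \<int>"
      using p_pos by (simp add: field_simps)
    then have "to_rmodz ((real p - of_int (a i k)) / p) = to_rmodz (- of_int (a i k) / p)"
      by (subst to_rmodz_eq_iff)
    then show ?thesis
      by (simp add: gen_coord_def num_def zero_rmodz_def)
  qed
  show "gen p d s a i j = torus_point d (lift_gen i) j"
  proof (cases "j \<le> d")
    case True
    then show ?thesis
      by (simp add: gen_def coord torus_point_def lift_gen_def to_rmodz_sum flip: uminus_rmodz.abs_eq)
  next
    case False
    then have "j > s i" using s_bounds [OF i] by simp
    then have "num i j = 0" by (simp add: num_def)
    with False show ?thesis by (simp add: gen_def coord torus_point_def zero_rmodz_def)
  qed
qed

lemma gen_group_explicit:
  "torus_point d c \<in> group_closure (gen p d s a ` {1..l}) \<longleftrightarrow>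
    (\<exists>n::nat \<Rightarrow> int. \<forall>k\<le>d. c k - (\<Sum>i=1..l. of_int (n i) * lift_gen i k) \<in> \<int>)"
proof -
  have "gen p d s a ` {1..l} = (\<lambda>i. torus_point d (lift_gen i)) ` {1..l}"
    by (intro image_cong refl gen_eq_torus_point)
  then show ?thesis using torus_point_in_group_closure_iff [of "{1..l}"] by simp
qed

lemma gen_group_denominator:
  assumes "torus_point d c \<in> group_closure (gen p d s a ` {1..l})" "k \<le> d"
  shows "real p * c k \<in> \<int>"
proof -
  from assms obtain n :: "nat \<Rightarrow> int"
    where n: "c k - (\<Sum>i=1..l. of_int (n i) * lift_gen i k) \<in> \<int>"
    unfolding gen_group_explicit by blast
  have lift: "real p * lift_gen i k \<in> \<int>" for i
    using p_pos by (auto simp: lift_gen_def sum_distrib_left)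
  have "real p * c k = real p * (c k - (\<Sum>i=1..l. of_int (n i) * lift_gen i k)) +
      (\<Sum>i=1..l. of_int (n i) * (real p * lift_gen i k))"
    by (simp add: algebra_simps sum_distrib_left)
  also have "\<dots> \<in> \<int>" by (intro Ints_add Ints_mult [OF Ints_of_nat n] Ints_mult [OF Ints_of_int lift] Ints_sum)
  finally show ?thesis .
qed

text \<open>
  A point of the group is \<open>\<Sum>i. n i * g i\<close>, and reading off the pivot coordinates determines \<open>n i\<close> modulo
  \<open>p\<close> as \<open>p * c (s i)\<close>. The remaining condition is that subtracting \<open>c (s i)\<close> times the \<open>i\<close>-th row of
  numerators makes the other columns integral; there a change of \<open>c (s i)\<close> by an integer is harmless.
\<close>

lemma gen_group_iff:
  assumes sum: "(\<Sum>k\<le>d. c k) \<in> \<int>"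
  shows "torus_point d c \<in> group_closure (gen p d s a ` {1..l}) \<longleftrightarrow>
    (\<forall>i\<in>{1..l}. real p * c (s i) \<in> \<int>) \<and>
    (\<forall>j\<in>{1..d} - S. c j - (\<Sum>i=1..l. of_int (num i j) * c (s i)) \<in> \<int>)"
    (is "?lhs \<longleftrightarrow> ?A \<and> ?B")
proof
  assume L: ?lhs
  then obtain n :: "nat \<Rightarrow> int"
    where n: "\<And>k. k \<le> d \<Longrightarrow> c k - (\<Sum>i=1..l. of_int (n i) * lift_gen i k) \<in> \<int>"
    unfolding gen_group_explicit by blast
  have ?A using gen_group_denominator [OF L] s_bounds(2) by blast
  have pivot: "c (s i) - of_int (n i) / p \<in> \<int>" if i: "i \<in> {1..l}" for i
  proof -
    have "(\<Sum>i'=1..l. of_int (n i') * lift_gen i' (s i)) =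
        (\<Sum>i'=1..l. if i' = i then of_int (n i) / real p else 0)"
      using s_bounds [OF i] i by (intro sum.cong refl) (auto simp: lift_gen_def num_s)
    then show ?thesis using n [of "s i"] s_bounds [OF i] i by simp
  qed
  moreover have ?B
  proof
    fix j assume j: "j \<in> {1..d} - S"
    have "c j - (\<Sum>i=1..l. of_int (num i j) * c (s i)) =
        (c j - (\<Sum>i=1..l. of_int (n i) * lift_gen i j)) -
        (\<Sum>i=1..l. of_int (num i j) * (c (s i) - of_int (n i) / p))"
      using j by (simp add: lift_gen_def right_diff_distrib sum_subtractf mult.commute)
    also have "\<dots> \<in> \<int>"
      using j by (intro Ints_diff [OF n] Ints_sum Ints_mult [OF Ints_of_int pivot]) auto
    finally show "c j - (\<Sum>i=1..l. of_int (num i j) * c (s i)) \<in> \<int>" .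
  qed
  ultimately show "?A \<and> ?B" using \<open>?A\<close> by blast
next
  assume "?A \<and> ?B"
  then have A: ?A and B: ?B by auto
  define n where "n i = \<lfloor>real p * c (s i)\<rfloor>" for i
  have n: "of_int (n i) = real p * c (s i)" if "i \<in> {1..l}" for i
    using A that by (simp add: n_def)
  let ?e = "\<lambda>k. c k - (\<Sum>i=1..l. of_int (n i) * lift_gen i k)"
  have comb: "(\<Sum>i=1..l. of_int (n i) * lift_gen i k) = (\<Sum>i=1..l. of_int (num i k) * c (s i))"
    if "k \<noteq> 0" for k
    using that p_pos by (intro sum.cong refl) (simp add: n lift_gen_def)
  have pos: "?e k \<in> \<int>" if k: "k \<in> {1..d}" for k
  proof (cases "k \<in> S")
    case True
    then obtain i where i: "i \<in> {1..l}" "k = s i" by (auto simp: S_def)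
    have "(\<Sum>i'=1..l. of_int (num i' k) * c (s i')) = (\<Sum>i'=1..l. if i' = i then c k else 0)"
      using i by (intro sum.cong refl) (auto simp: num_s)
    then show ?thesis using comb [of k] k i by simp
  next
    case False
    then show ?thesis using B comb [of k] k by simp
  qed
  \<comment> \<open>The coordinate at 0 is determined by the others, because both sides have integral coordinate sum.\<close>
  have split: "(\<Sum>k\<le>d. f k) = f 0 + (\<Sum>k=1..d. f k)" for f :: "nat \<Rightarrow> real"
    by (simp add: sum.atMost_shift sum.shift_bounds_cl_Suc_ivl atMost_atLeast0 sum.atLeast_Suc_atMost)
  have "(\<Sum>k\<le>d. lift_gen i k) = 0" for i
    unfolding split by (simp add: lift_gen_def)
  then have "(\<Sum>k\<le>d. \<Sum>i=1..l. of_int (n i) * lift_gen i k) = 0"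
    by (subst sum.swap) (simp flip: sum_distrib_left)
  then have "(\<Sum>k\<le>d. ?e k) = (\<Sum>k\<le>d. c k)" by (simp add: sum_subtractf)
  then have "?e 0 = (\<Sum>k\<le>d. c k) - (\<Sum>k=1..d. ?e k)" unfolding split by linarith
  also have "\<dots> \<in> \<int>" by (intro Ints_diff [OF sum Ints_sum] pos)
  finally have "?e 0 \<in> \<int>" .
  then have "?e k \<in> \<int>" if "k \<le> d" for k
    using pos [of k] that by (cases "k = 0") auto
  then show ?lhs unfolding gen_group_explicit by blast
qed

text \<open>
  This is the sum of all generators. In terms of the criterion \<open>gen_group_iff\<close>, the coordinate sum is
  \<open>(d + 1) / p = r\<close>, and in every column that is not a pivot the congruence satisfied by the column sum of \<open>a\<close> makes
  the numerators add up to 1 modulo \<open>p\<close>.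
\<close>

lemma barycenter_in_gen_group:
  assumes r: "int d = r * int p - 1"
    and t: "\<And>j. 1 \<le> j \<Longrightarrow> j < d \<Longrightarrow> j \<notin> S \<Longrightarrow>
           \<exists>t::int. (\<Sum>i | i \<in> {1..l} \<and> j < s i. a i j) = t * int p - 1"
  shows "torus_point d (\<lambda>_. 1 / p) \<in> group_closure (gen p d s a ` {1..l})"
proof (subst gen_group_iff)
  have "real d + 1 = of_int r * real p"
    using arg_cong [OF r, of real_of_int] by simp
  then have "(\<Sum>k\<le>d. 1 / real p) = of_int r" using p_pos by (simp add: field_simps)
  then show "(\<Sum>k\<le>d. 1 / real p) \<in> \<int>" by simp
  have "1 / p - (\<Sum>i=1..l. of_int (num i j) * (1 / p)) \<in> \<int>" if j: "j \<in> {1..d} - S" for j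
  proof -
    have "d \<in> S" using s_l l_pos by (auto simp: S_def)
    with j have jd: "j < d" by (metis DiffD1 DiffD2 atLeastAtMost_iff nat_less_le)
    then obtain t where t: "(\<Sum>i | i \<in> {1..l} \<and> j < s i. a i j) = t * int p - 1"
      using t [of j] j by auto
    have "j \<notin> s ` {1..<i}" "j \<noteq> s i" if "i \<in> {1..l}" for i using j that by (auto simp: S_def)
    then have "(\<Sum>i=1..l. num i j) = (\<Sum>i\<in>{1..l}. if j < s i then - a i j else 0)"
      using j by (intro sum.cong refl) (auto simp: num_def)
    also have "\<dots> = - (\<Sum>i | i \<in> {1..l} \<and> j < s i. a i j)"
      by (simp add: sum.If_cases sum_negf Int_def)
    finally have "(\<Sum>i=1..l. num i j) = 1 - t * int p" using t by simp
    from arg_cong [OF this, of real_of_int]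
    have "(\<Sum>i=1..l. real_of_int (num i j)) = 1 - of_int t * real p" by simp
    then have "1 / p - (\<Sum>i=1..l. of_int (num i j) * (1 / p)) = of_int t"
      using p_pos by (simp flip: sum_divide_distrib) (simp add: field_simps)
    then show ?thesis by simp
  qed
  then show "(\<forall>i\<in>{1..l}. real p * (1 / real p) \<in> \<int>) \<and>
      (\<forall>j\<in>{1..d} - S. 1 / real p - (\<Sum>i=1..l. of_int (num i j) * (1 / p)) \<in> \<int>)"
    using p_pos by simp
qed

end

section \<open>Barycentric functionals\<close>

text \<open>
  The \<open>u i\<close> with \<open>i \<ge> 1\<close> are the basis dual to the edge vectors \<open>v i - v 0\<close>, i.e. the rows of the inverse of the
  edge matrix, and \<open>u 0\<close> is chosen to make the sum vanish. With this choice all vertices play the same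
  role in the conclusions.
\<close>

lemma affine_dual_basis:
  fixes v :: "nat \<Rightarrow> real ^ 'n"
  assumes card: "CARD('n) = d" and inj: "inj_on v {..d}" and indep: "\<not> affine_dependent (v ` {..d})"
  obtains u :: "nat \<Rightarrow> real ^ 'n" where
    "(\<Sum>i\<le>d. u i) = 0"
    "\<And>i j k. i \<le> d \<Longrightarrow> j \<le> d \<Longrightarrow> k \<le> d \<Longrightarrow>
       u i \<bullet> (v j - v k) = (if i = j then 1 else 0) - (if i = k then 1 else 0)"
    "\<And>x. (\<Sum>i\<le>d. (u i \<bullet> x) *\<^sub>R v i) = x"
    "\<And>y. (\<Sum>i\<le>d. (v i \<bullet> y) *\<^sub>R u i) = y"
proof -
  obtain h :: "'n \<Rightarrow> nat" where h: "bij_betw h UNIV {1..d}"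
    using finite_same_card_bij [of "UNIV :: 'n set" "{1..d}"] card by auto
  have h_range: "h j \<in> {1..d}" for j using h by (auto simp: bij_betw_def)
  have inj_h: "h j = h k \<longleftrightarrow> j = k" for j k using h by (auto simp: bij_betw_def inj_on_def)
  define g where "g = inv_into UNIV h"
  have gh: "g (h j) = j" for j using h by (simp add: g_def bij_betw_def)
  have sum_h: "(\<Sum>i\<in>{1..d}. F i) = (\<Sum>j\<in>UNIV. F (h j))" for F :: "nat \<Rightarrow> 'b::comm_monoid_add"
    by (rule sum.reindex_bij_betw [OF h, symmetric])
  have split: "(\<Sum>i\<le>d. F i) = F 0 + (\<Sum>j\<in>UNIV. F (h j))" for F :: "nat \<Rightarrow> 'b::comm_monoid_add"
    by (simp add: atMost_atLeast0 sum.atLeast_Suc_atMost flip: sum_h)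
  define f where "f j = v (h j) - v 0" for j
  have vh: "v (h j) = v (h k) \<longleftrightarrow> j = k" "v (h j) \<noteq> v 0" for j k
    using inj_onD [OF inj, of "h j" "h k"] inj_onD [OF inj, of "h j" 0] h_range [of j] h_range [of k] inj_h
    by auto
  have inj_f: "inj f" by (auto simp: inj_def f_def vh)
  have "v ` {..d} - {v 0} = (\<lambda>j. v (h j)) ` UNIV"
  proof -
    have "{..d} = insert 0 (h ` UNIV)" using h by (auto simp: bij_betw_def)
    then show ?thesis using vh by auto
  qed
  then have "(\<lambda>x. - v 0 + x) ` (v ` {..d} - {v 0}) = range f"
    by (simp add: image_image f_def)
  then have indep_f: "independent (range f)"
    using indep affine_dependent_iff_dependent2 [of "v 0" "v ` {..d}"] by simp
  define V :: "real ^ 'n ^ 'n" where "V = (\<chi> k j. f j $ k)"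
  have col: "column j V = f j" for j by (simp add: V_def column_def)
  have "\<exists>U. U ** V = mat 1"
    unfolding matrix_left_invertible_independent_columns
  proof (intro allI impI)
    fix c :: "'n \<Rightarrow> real" and j
    assume "(\<Sum>i\<in>UNIV. c i *s column i V) = 0"
    then have "(\<Sum>x\<in>range f. c (inv f x) *\<^sub>R x) = 0"
      using inj_f by (simp add: sum.reindex col scalar_mult_eq_scaleR)
    then have "c (inv f (f j)) = 0"
      using independentD [OF indep_f, of "range f" "\<lambda>x. c (inv f x)" "f j"] by simp
    then show "c j = 0" using inj_f by simp
  qed
  then obtain U where UV: "U ** V = mat 1" by blast
  then have VU: "V ** U = mat 1" by (simp add: matrix_left_right_inverse)
  have dual: "U $ i \<bullet> f j = (if i = j then 1 else 0)" for i j
  proof -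
    have "U $ i \<bullet> f j = (U ** V) $ i $ j"
      by (simp add: inner_vec_def matrix_matrix_mult_def V_def)
    then show ?thesis by (simp add: UV mat_def)
  qed
  define u where "u i = (if i = 0 then - (\<Sum>j\<in>UNIV. U $ j) else U $ g i)" for i
  have uh: "u (h j) = U $ j" for j using h_range [of j] by (simp add: u_def gh)
  have sum_u: "(\<Sum>i\<le>d. u i) = 0" by (simp add: split uh u_def [of 0])
  have base: "u i \<bullet> (v j - v 0) = (if i = j then 1 else 0) - (if i = 0 then 1 else 0)"
    if "i \<le> d" "j \<le> d" for i j
  proof -
    have "\<exists>k. i = h k" if "i \<le> d" "i \<noteq> 0" for i
      using that h by (metis One_nat_def Suc_leI atLeastAtMost_iff bij_betw_iff_bijections bot_nat_0.not_eq_extremum)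
    then consider "j = 0" | k where "i = 0" "j = h k" | k m where "i = h m" "j = h k" "i \<noteq> 0"
      using \<open>i \<le> d\<close> \<open>j \<le> d\<close> by metis
    then show ?thesis
    proof cases
      case (2 k)
      then show ?thesis using h_range [of k]
        by (simp add: u_def [of 0] inner_sum_left dual flip: f_def)
    next
      case (3 k m)
      then show ?thesis using dual [of m k] by (simp add: uh inj_h f_def)
    qed simp
  qed
  have *: "u i \<bullet> (v j - v k) = (if i = j then 1 else 0) - (if i = k then 1 else 0)"
    if "i \<le> d" "j \<le> d" "k \<le> d" for i j k
    using base [of i j] base [of i k] that by (simp add: inner_diff_right)
  have 1: "(\<Sum>i\<le>d. (u i \<bullet> x) *\<^sub>R v i) = x" for x
  proof -
    have "(\<Sum>i\<le>d. (u i \<bullet> x) *\<^sub>R v i) = (\<Sum>i\<le>d. (u i \<bullet> x) *\<^sub>R (v i - v 0)) + (\<Sum>i\<le>d. u i \<bullet> x) *\<^sub>R v 0"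
      by (simp add: scaleR_diff_right sum_subtractf scaleR_sum_left)
    also have "(\<Sum>i\<le>d. u i \<bullet> x) = 0"
      by (simp only: inner_sum_left [symmetric] sum_u inner_zero_left)
    also have "(\<Sum>i\<le>d. (u i \<bullet> x) *\<^sub>R (v i - v 0)) + 0 *\<^sub>R v 0 = (\<Sum>j\<in>UNIV. (U $ j \<bullet> x) *\<^sub>R f j)"
      by (simp add: split uh f_def)
    also have "\<dots> = V *v (U *v x)"
      by (simp add: matrix_mult_sum [of V] col scalar_mult_eq_scaleR matrix_vector_mul_component)
    also have "\<dots> = x" by (simp add: matrix_vector_mul_assoc VU)
    finally show ?thesis .
  qed
  have 2: "(\<Sum>i\<le>d. (v i \<bullet> y) *\<^sub>R u i) = y" for y
  proof -
    have "(\<Sum>i\<le>d. (v i \<bullet> y) *\<^sub>R u i) \<bullet> x = (\<Sum>i\<le>d. (u i \<bullet> x) *\<^sub>R v i) \<bullet> y" for x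
      by (simp add: inner_sum_left mult.commute)
    then have "(\<Sum>i\<le>d. (v i \<bullet> y) *\<^sub>R u i) \<bullet> x = y \<bullet> x" for x
      unfolding 1 by (simp only: inner_commute [of y])
    then show ?thesis using vector_eq_rdot by blast
  qed
  show ?thesis by (rule that [OF sum_u * 1 2])
qed

section \<open>The reflexive translate and its dual\<close>

text \<open>
  The setting of a lattice simplex for which the barycentre of the dilate by \<open>r\<close> is a lattice point and all
  barycentric coordinates of lattice points have denominator \<open>p\<close>, where \<open>r p = d + 1\<close>.
\<close>

locale barycentric_lattice_simplex =
  fixes d p :: nat and r :: int and v u :: "nat \<Rightarrow> real ^ 'n" and m :: "real ^ 'n"
  assumes card: "CARD('n) = d" and d_pos: "d > 0" and p_pos: "p > 0"
    and rp: "of_int r * real p = real d + 1"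
    and sum_u: "(\<Sum>i\<le>d. u i) = 0"
    and u_v: "\<And>i j k. i \<le> d \<Longrightarrow> j \<le> d \<Longrightarrow> k \<le> d \<Longrightarrow>
       u i \<bullet> (v j - v k) = (if i = j then 1 else 0) - (if i = k then 1 else 0)"
    and sum_uv: "\<And>x. (\<Sum>i\<le>d. (u i \<bullet> x) *\<^sub>R v i) = x"
    and sum_vu: "\<And>y. (\<Sum>i\<le>d. (v i \<bullet> y) *\<^sub>R u i) = y"
    and m: "m = (1 / p) *\<^sub>R (\<Sum>i\<le>d. v i)"
    and v_int: "\<And>i. i \<le> d \<Longrightarrow> v i \<in> int_lattice" and m_int: "m \<in> int_lattice"
    and u_int: "\<And>i x. i \<le> d \<Longrightarrow> x \<in> int_lattice \<Longrightarrow> real p * (u i \<bullet> x) \<in> \<int>"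
begin

abbreviation Q :: "(real ^ 'n) set" where
  "Q \<equiv> (\<lambda>x. of_int r *\<^sub>R x - m) ` (convex hull (v ` {..d}))"

definition w :: "nat \<Rightarrow> real ^ 'n" where
  "w i = - real p *\<^sub>R u i"

lemma r_pos: "r > 0"
proof -
  have "of_int r * real p > 0" using rp by simp
  then show ?thesis using p_pos by (simp add: zero_less_mult_iff)
qed

text \<open>
  The functional \<open>w i\<close> takes the value 1 on all vertices of \<open>Q\<close> except the \<open>i\<close>-th: it is the normal of
  the facet opposite to that vertex, so the \<open>w i\<close> are the candidates for the vertices of the dual.
\<close>

lemma w_vertex:
  assumes "i \<le> d" "j \<le> d"
  shows "w i \<bullet> (of_int r *\<^sub>R v j - m) = (if i = j then - real d else 1)"
proof -
  have "real p *\<^sub>R (of_int r *\<^sub>R v j - m) = (real d + 1) *\<^sub>R v j - (\<Sum>k\<le>d. v k)"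
    using p_pos rp by (simp add: m scaleR_diff_right mult.commute)
  also have "\<dots> = (\<Sum>k\<le>d. v j - v k)"
    by (simp add: sum_subtractf sum_constant_scaleR del: sum_constant)
  finally have "w i \<bullet> (of_int r *\<^sub>R v j - m) = - (\<Sum>k\<le>d. u i \<bullet> (v j - v k))"
    by (simp add: w_def flip: inner_scaleR_right inner_sum_right)
  also have "\<dots> = - (\<Sum>k\<le>d. (if i = j then 1 else 0) - (if i = k then 1 else 0))"
    using assms u_v by simp
  also have "\<dots> = (if i = j then - real d else 1)"
    using assms by (simp add: sum_subtractf)
  finally show ?thesis .
qed

lemma w_nonzero: "i \<le> d \<Longrightarrow> w i \<noteq> 0"
  using w_vertex [of i i] d_pos by auto

lemma inj_w: "inj_on w {..d}"
proof (rule inj_onI)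
  fix i j assume ij: "i \<in> {..d}" "j \<in> {..d}" "w i = w j"
  have "(if j = i then - real d else 1) = - real d"
    using w_vertex [of i i] w_vertex [of j i] ij by simp
  then show "i = j" using d_pos by (simp split: if_split_asm)
qed

lemma sum_w: "(\<Sum>i\<le>d. w i) = 0"
  using sum_u by (simp add: w_def sum_negf flip: scaleR_sum_right)

lemma w_int:
  assumes "i \<le> d" "x \<in> int_lattice"
  shows "w i \<bullet> x \<in> \<int>"
  using u_int [OF assms] by (simp add: w_def)

text \<open>
  One inclusion holds as the inequalities hold at the vertices. Conversely, the slacks in the inequalities,
  divided by \<open>r p\<close>, are the barycentric coordinates of \<open>(y + m) / r\<close>.
\<close>

lemma translate_eq_halfspaces: "Q = {y. \<forall>i\<le>d. w i \<bullet> y \<le> 1}"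
proof
  have "convex {x. \<forall>i\<le>d. w i \<bullet> (of_int r *\<^sub>R x - m) \<le> 1}"
  proof -
    have "{x. \<forall>i\<le>d. w i \<bullet> (of_int r *\<^sub>R x - m) \<le> 1} =
        (\<Inter>i\<in>{..d}. {x. (of_int r *\<^sub>R w i) \<bullet> x \<le> 1 + w i \<bullet> m})"
      by (auto simp: inner_diff_right algebra_simps)
    then show ?thesis by (simp only: convex_INT convex_halfspace_le)
  qed
  then have "convex hull (v ` {..d}) \<subseteq> {x. \<forall>i\<le>d. w i \<bullet> (of_int r *\<^sub>R x - m) \<le> 1}"
    by (intro hull_minimal) (auto simp: w_vertex)
  then show "Q \<subseteq> {y. \<forall>i\<le>d. w i \<bullet> y \<le> 1}" by auto
  show "{y. \<forall>i\<le>d. w i \<bullet> y \<le> 1} \<subseteq> Q"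
  proof
    fix y assume y: "y \<in> {y. \<forall>i\<le>d. w i \<bullet> y \<le> 1}"
    define b where "b i = (u i \<bullet> y + 1 / p) / of_int r" for i
    have "(\<Sum>i\<le>d. b i) = 1"
    proof -
      have "(\<Sum>i\<le>d. b i) = ((\<Sum>i\<le>d. u i) \<bullet> y + (real d + 1) / p) / of_int r"
        by (simp add: b_def sum.distrib inner_sum_left flip: sum_divide_distrib)
      also have "\<dots> = 1" using rp p_pos r_pos by (simp add: sum_u field_simps)
      finally show ?thesis .
    qed
    moreover have "b i \<ge> 0" if "i \<le> d" for i
    proof -
      have "real p * (u i \<bullet> y) \<ge> - 1" using y that by (auto simp: w_def)
      then have "u i \<bullet> y + 1 / p \<ge> 0" using p_pos by (simp add: field_simps)
      then show ?thesis using r_pos by (simp add: b_def)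
    qed
    ultimately have "(\<Sum>i\<le>d. b i *\<^sub>R v i) \<in> convex hull (v ` {..d})"
      by (intro convex_sum) (auto simp: hull_inc)
    moreover have "y = of_int r *\<^sub>R (\<Sum>i\<le>d. b i *\<^sub>R v i) - m"
      using r_pos sum_uv [of y] 
      by (simp add: b_def scaleR_sum_right scaleR_add_left sum.distrib m)
    ultimately show "y \<in> Q" by blast
  qed
qed

text \<open>
  Dually to the previous lemma, the slacks \<open>1 - (r v i - m) \<bullet> y\<close>, divided by \<open>r p\<close>, are the barycentric
  coordinates of \<open>y\<close> with respect to the \<open>w i\<close>.
\<close>

lemma dual_eq_hull: "dual_polytope Q = convex hull (w ` {..d})"
proof
  have "dual_polytope Q = (\<Inter>x\<in>Q. {y. x \<bullet> y \<le> 1})"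
    by (auto simp: dual_polytope_def)
  then have "convex (dual_polytope Q)" by (simp only: convex_INT convex_halfspace_le)
  moreover have "w i \<in> dual_polytope Q" if "i \<le> d" for i
    unfolding dual_polytope_def translate_eq_halfspaces using that by (auto simp: inner_commute)
  ultimately show "convex hull (w ` {..d}) \<subseteq> dual_polytope Q"
    by (intro hull_minimal) auto
  show "dual_polytope Q \<subseteq> convex hull (w ` {..d})"
  proof
    fix y assume y: "y \<in> dual_polytope Q"
    have vert: "of_int r * (v i \<bullet> y) - m \<bullet> y \<le> 1" if "i \<le> d" for i
    proof -
      have "v i \<in> convex hull (v ` {..d})" using that by (simp add: hull_inc)
      then have "(of_int r *\<^sub>R v i - m) \<bullet> y \<le> 1" using y by (auto simp: dual_polytope_def)
      then show ?thesis by (simp add: inner_diff_left)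
    qed
    define b where "b i = (1 + m \<bullet> y - of_int r * (v i \<bullet> y)) / (of_int r * real p)" for i
    have "(\<Sum>i\<le>d. v i \<bullet> y) = real p * (m \<bullet> y)"
      using p_pos by (simp add: m inner_sum_left)
    then have "(\<Sum>i\<le>d. b i) =
        ((real d + 1) * (1 + m \<bullet> y) - of_int r * (real p * (m \<bullet> y))) / (of_int r * real p)"
      by (simp add: b_def sum_subtractf flip: sum_divide_distrib sum_distrib_left)
    also have "\<dots> = 1" unfolding rp [symmetric] using r_pos p_pos by (simp add: field_simps)
    finally have "(\<Sum>i\<le>d. b i) = 1" .
    moreover have "b i \<ge> 0" if "i \<le> d" for i
      using vert [OF that] r_pos p_pos by (simp add: b_def)
    ultimately have "(\<Sum>i\<le>d. b i *\<^sub>R w i) \<in> convex hull (w ` {..d})"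
      by (intro convex_sum) (auto simp: hull_inc)
    also have "(\<Sum>i\<le>d. b i *\<^sub>R w i) = y"
    proof -
      have "b i *\<^sub>R w i = (v i \<bullet> y) *\<^sub>R u i - ((1 + m \<bullet> y) / of_int r) *\<^sub>R u i" for i
      proof -
        have "b i * - real p = v i \<bullet> y - (1 + m \<bullet> y) / of_int r"
          using r_pos p_pos by (simp add: b_def field_simps)
        then show ?thesis unfolding w_def scaleR_scaleR scaleR_diff_left [symmetric] by simp
      qed
      then show ?thesis
        by (simp add: sum_subtractf sum_vu sum_u flip: scaleR_sum_right)
    qed
    finally show "y \<in> convex hull (w ` {..d})" .
  qed
qed

lemma interior_translate: "interior Q = {y. \<forall>i\<le>d. w i \<bullet> y < 1}"
proof
  have "interior Q \<subseteq> {y. w i \<bullet> y < 1}" if "i \<le> d" for i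
  proof -
    have "Q \<subseteq> {y. w i \<bullet> y \<le> 1}" using that unfolding translate_eq_halfspaces by blast
    then show ?thesis using interior_mono interior_halfspace_le [OF w_nonzero [OF that]] by metis
  qed
  then show "interior Q \<subseteq> {y. \<forall>i\<le>d. w i \<bullet> y < 1}" by blast
  have "{y. \<forall>i\<le>d. w i \<bullet> y < 1} = (\<Inter>i\<in>{..d}. {y. w i \<bullet> y < 1})" by auto
  also have "open \<dots>" by (intro open_INT finite_atMost ballI open_halfspace_lt)
  finally show "{y. \<forall>i\<le>d. w i \<bullet> y < 1} \<subseteq> interior Q"
    unfolding translate_eq_halfspaces by (intro interior_maximal) auto
qed

text \<open>
  On an interior lattice point the \<open>w i\<close> take integer values below 1 that sum to zero, so
  they all vanish.
\<close>

lemma interior_translate_lattice: "interior Q \<inter> int_lattice = {0}"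
proof
  show "{0} \<subseteq> interior Q \<inter> int_lattice"
    by (simp add: interior_translate int_lattice_0)
  show "interior Q \<inter> int_lattice \<subseteq> {0}"
  proof
    fix y assume "y \<in> interior Q \<inter> int_lattice"
    then have lt: "w i \<bullet> y < 1" and int: "w i \<bullet> y \<in> \<int>" if "i \<le> d" for i
      using that by (auto simp: interior_translate w_int)
    have le: "w i \<bullet> y \<le> 0" if "i \<le> d" for i
      using lt [OF that] int [OF that] by (auto elim!: Ints_cases)
    have "(\<Sum>i\<le>d. - (w i \<bullet> y)) = 0"
      using sum_w by (simp add: sum_negf flip: inner_sum_left)
    then have "w i \<bullet> y = 0" if "i \<le> d" for i
      using le that by (subst (asm) sum_nonneg_eq_0_iff) auto
    then have "u i \<bullet> y = 0" if "i \<le> d" for i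
      using p_pos that by (simp add: w_def)
    then show "y \<in> {0}" using sum_uv [of y] by simp
  qed
qed

lemma reflexive_translate: "reflexive_polytope Q"
proof -
  have "Q = convex hull ((\<lambda>x. of_int r *\<^sub>R x - m) ` v ` {..d})"
    using convex_hull_affinity [of "- m" "of_int r" "v ` {..d}"] by simp
  moreover have "lattice_polytope \<dots>"
    using v_int m_int by (intro lattice_polytope_hull) (auto intro!: int_lattice_diff int_lattice_scaleR)
  ultimately have "lattice_polytope Q" by simp
  moreover have "interior Q \<noteq> {}" using interior_translate_lattice by blast
  then have "aff_dim Q = int CARD('n)" by (simp add: aff_dim_nonempty_interior)
  moreover have "w i \<in> int_lattice" if "i \<le> d" for i
    unfolding int_lattice_def
  proof (intro CollectI allI)
    fix k
    show "w i $ k \<in> \<int>"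
      using w_int [OF that int_lattice_axis [of k]] by (simp add: cart_eq_inner_axis)
  qed
  then have "lattice_polytope (dual_polytope Q)"
    unfolding dual_eq_hull by (intro lattice_polytope_hull) auto
  ultimately show ?thesis
    using interior_translate_lattice by (simp add: reflexive_polytope_def full_dim_lattice_polytope_def)
qed

lemma interior_dilate_lattice:
  "interior ((*\<^sub>R) (of_int r) ` (convex hull (v ` {..d}))) \<inter> int_lattice = {m}"
proof -
  have "(*\<^sub>R) (of_int r) ` (convex hull (v ` {..d})) = (+) m ` Q"
    by (simp add: image_image)
  then have "interior ((*\<^sub>R) (of_int r) ` (convex hull (v ` {..d}))) \<inter> int_lattice =
      (+) m ` interior Q \<inter> int_lattice"
    by (simp only: interior_translation)
  also have "\<dots> = (+) m ` (interior Q \<inter> int_lattice)"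
    using m_int int_lattice_add [of m] int_lattice_diff [of "m + _" m] by auto
  also have "\<dots> = {m}" by (simp add: interior_translate_lattice)
  finally show ?thesis .
qed

text \<open>
  Substituting \<open>w 0 = - (\<Sum>i\<ge>1. w i)\<close>, the edge matrix of the dual simplex factors into the scalar \<open>- p\<close>, the
  identity plus the all-ones matrix, and the matrix of the \<open>u i\<close>.
\<close>

lemma volume_dual:
  assumes h: "bij_betw h (UNIV :: 'n set) {1..d}"
  shows "normalized_volume (dual_polytope Q) = real p ^ d * (real d + 1) * \<bar>det (\<chi> j. u (h j))\<bar>"
proof -
  let ?E = "\<chi> i j. (if i = j then 1 else 0) + 1 :: real ^ 'n ^ 'n"
  let ?U = "(\<chi> j. u (h j)) :: real ^ 'n ^ 'n"
  let ?M = "(\<chi> i j. w (h j) $ i - w 0 $ i) :: real ^ 'n ^ 'n"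
  have rest: "w ` {..d} - {w 0} = w ` {1..d}"
  proof -
    have "{1..d} = {..d} - {0}" by auto
    then show ?thesis using inj_on_image_set_diff [OF inj_w, of "{..d}" "{0}"] by auto
  qed
  have "inj_on w {1..d}" using inj_w by (rule inj_on_subset) auto
  then have "bij_betw (\<lambda>j. w (h j)) UNIV (w ` {1..d})"
    using bij_betw_trans [OF h inj_on_imp_bij_betw] by (simp only: o_def)
  then have "measure lborel (convex hull (w ` {..d})) = \<bar>det ?M\<bar> / fact CARD('n)"
    using card inj_w by (intro content_simplex_finite) (auto simp: card_image rest)
  moreover have "convex hull (w ` {..d}) \<in> sets borel"
    by (intro borel_compact finite_imp_compact_convex_hull) simp
  ultimately have vol: "normalized_volume (dual_polytope Q) = \<bar>det ?M\<bar>"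
    by (simp add: normalized_volume_def dual_eq_hull)
  have w0: "w 0 = - (\<Sum>k\<in>UNIV. w (h k))"
  proof -
    have "(\<Sum>i\<le>d. w i) = w 0 + (\<Sum>i\<in>{1..d}. w i)"
      by (simp add: atMost_atLeast0 sum.atLeast_Suc_atMost)
    also have "(\<Sum>i\<in>{1..d}. w i) = (\<Sum>k\<in>UNIV. w (h k))"
      by (rule sum.reindex_bij_betw [OF h, symmetric])
    finally show ?thesis using sum_w by (simp add: eq_neg_iff_add_eq_0)
  qed
  have "transpose ?M = (\<chi> j. (- real p) *s (?E ** ?U) $ j)"
  proof (simp add: vec_eq_iff transpose_def, intro allI)
    fix j i
    have "(?E ** ?U) $ j $ i = u (h j) $ i + (\<Sum>k\<in>UNIV. u (h k) $ i)"
      by (simp add: matrix_matrix_mult_def distrib_right sum.distrib if_distrib [where f = "\<lambda>z. z * _"]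
          cong: if_cong)
    moreover have "w (h j) $ i - w 0 $ i = w (h j) $ i + (\<Sum>k\<in>UNIV. w (h k) $ i)"
      by (simp add: w0)
    ultimately show "w (h j) $ i - w 0 $ i = - (real p * (?E ** ?U) $ j $ i)"
      by (simp add: w_def distrib_left sum_distrib_left sum_negf)
  qed
  then have "det ?M = (- real p) ^ d * det (?E ** ?U)"
    using det_rows_mul [of "\<lambda>_. - real p" "($) (?E ** ?U)"] det_transpose [of ?M] card by simp
  also have "det (?E ** ?U) = (real d + 1) * det ?U"
    using det_identity_plus_ones [where 'n = 'n] card by (simp add: det_mul)
  finally show ?thesis unfolding vol by (simp add: abs_mult power_abs)
qed

end

section \<open>The determinant of the barycentric functionals\<close>

text \<open>
  Let \<open>H\<close> be the matrix of the integrality conditions in \<open>gen_group_iff\<close>, and \<open>U\<close> the matrix with rows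
  \<open>u 1, \<dots>, u d\<close>. By the description of \<open>\<Lambda>\<close>, a vector is a lattice vector iff \<open>H ** U\<close> maps it to one, so
  \<open>H ** U\<close> is unimodular. Here \<open>H\<close> is an elimination matrix \<open>1 - N\<close> with its \<open>l\<close> pivot rows scaled by \<open>p\<close>.
\<close>

lemma (in generator_data) det_dual_basis:
  fixes u v :: "nat \<Rightarrow> real ^ 'n"
  assumes h: "bij_betw h (UNIV :: 'n set) {1..d}"
    and v: "\<And>i. i \<le> d \<Longrightarrow> v i \<in> int_lattice"
    and sum_u: "(\<Sum>i\<le>d. u i) = 0" and sum_uv: "\<And>x. (\<Sum>i\<le>d. (u i \<bullet> x) *\<^sub>R v i) = x"
    and Lambda: "Lambda_group d v = group_closure (gen p d s a ` {1..l})"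
  shows "\<bar>det (\<chi> k. u (h k))\<bar> = 1 / real p ^ l"
proof -
  have h_range: "h j \<in> {1..d}" for j using h by (auto simp: bij_betw_def)
  define U :: "real ^ 'n ^ 'n" where "U = (\<chi> k. u (h k))"
  have Ux: "(U *v x) $ k = u (h k) \<bullet> x" for x k
    by (simp add: U_def matrix_vector_mul_component)
  define pivots where "pivots = {k. h k \<in> S}"
  define row_of where "row_of k = inv_into {1..l} s (h k)" for k
  have pivot_bij: "bij_betw row_of pivots {1..l}"
  proof -
    have "S \<subseteq> {1..d}" using s_bounds by (auto simp: S_def)
    then have "bij_betw h pivots S"
      unfolding pivots_def using bij_betw_subset [OF h, of "{k. h k \<in> S}"] h
      by (auto simp: bij_betw_def)
    moreover have "bij_betw (inv_into {1..l} s) S {1..l}"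
      unfolding S_def by (intro bij_betw_inv_into inj_on_imp_bij_betw inj_s)
    ultimately show ?thesis unfolding row_of_def using bij_betw_trans by (fastforce simp: o_def)
  qed
  have s_row_of: "s (row_of k) = h k" if "k \<in> pivots" for k
    using that f_inv_into_f [of "h k" s "{1..l}"] by (simp add: pivots_def row_of_def S_def)
  define N :: "real ^ 'n ^ 'n" where
    "N = (\<chi> k j. if k \<notin> pivots \<and> j \<in> pivots then of_int (num (row_of j) (h k)) else 0)"
  define D :: "'n \<Rightarrow> real" where "D k = (if k \<in> pivots then real p else 1)" for k
  define H :: "real ^ 'n ^ 'n" where "H = (\<chi> k. D k *s (mat 1 - N) $ k)"
  \<comment> \<open>\<open>N\<close> has nonzero entries only in pivot columns and non-pivot rows.\<close>
  have "N ** N = 0"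
    by (auto simp: N_def matrix_matrix_mult_def vec_eq_iff intro!: sum.neutral)
  then have "\<bar>det (mat 1 - N)\<bar> = 1"
    by (intro det_one_minus_square_zero) (simp_all add: N_def)
  moreover have "(\<Prod>k\<in>UNIV. D k) = real p ^ l"
  proof -
    have "card pivots = l" using bij_betw_same_card [OF pivot_bij] by simp
    then show ?thesis unfolding D_def by (simp add: prod.If_cases)
  qed
  moreover have "det H = (\<Prod>k\<in>UNIV. D k) * det (mat 1 - N)"
    unfolding H_def using det_rows_mul [of D "\<lambda>k. (mat 1 - N) $ k"] by (simp only: vec_lambda_eta)
  ultimately have det_H: "\<bar>det H\<bar> = real p ^ l" by (simp add: abs_mult)
  have "U *v x = 0 \<Longrightarrow> x = 0" for x
  proof -
    assume "U *v x = 0"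
    then have z: "u (h k) \<bullet> x = 0" for k by (metis Ux zero_index)
    have pos: "u i \<bullet> x = 0" if "i \<in> {1..d}" for i
      using z that h by (metis bij_betw_iff_bijections)
    have "(\<Sum>i\<le>d. u i \<bullet> x) = 0" using sum_u by (simp flip: inner_sum_left)
    then have "u 0 \<bullet> x = 0"
      using pos by (simp add: atMost_atLeast0 sum.atLeast_Suc_atMost)
    then have "u i \<bullet> x = 0" if "i \<le> d" for i using pos [of i] that by (cases "i = 0") auto
    then show "x = 0" using sum_uv [of x] by simp
  qed
  then have "det U \<noteq> 0"
    using matrix_left_invertible_ker [of U] invertible_left_inverse [of U] invertible_det_nz [of U] by blast
  then have "invertible (H ** U)"
    using det_H p_pos by (simp add: invertible_det_nz det_mul) (metis abs_zero power_not_zero of_nat_0_less_iff less_numeral_extra(3))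
  moreover have "(H ** U) *v x \<in> int_lattice \<longleftrightarrow> x \<in> int_lattice" for x
  proof -
    let ?c = "\<lambda>i. u i \<bullet> x"
    have sum_c: "(\<Sum>i\<le>d. ?c i) = 0" using sum_u by (simp flip: inner_sum_left)
    have HU: "((H ** U) *v x) $ k = (if k \<in> pivots then real p * ?c (h k)
        else ?c (h k) - (\<Sum>i=1..l. of_int (num i (h k)) * ?c (s i)))" for k
    proof -
      have "((H ** U) *v x) $ k = D k * (((mat 1 - N) *v (U *v x)) $ k)"
        by (simp add: H_def matrix_vector_mul_component scalar_mult_eq_scaleR inner_diff_left
            scaleR_diff_right right_diff_distrib flip: matrix_vector_mul_assoc)
      also have "((mat 1 - N) *v (U *v x)) $ k = ?c (h k) - (N *v (U *v x)) $ k"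
        by (simp add: matrix_vector_mult_diff_rdistrib Ux)
      also have "(N *v (U *v x)) $ k = (\<Sum>j\<in>UNIV. N $ k $ j * ?c (h j))"
        unfolding matrix_vector_mult_def [of N] by (simp add: Ux)
      also have "\<dots> = (if k \<in> pivots then 0 else
          (\<Sum>j\<in>UNIV. if j \<in> pivots then of_int (num (row_of j) (h k)) * ?c (h j) else 0))"
        by (auto simp: N_def intro!: sum.cong)
      also have "(\<Sum>j\<in>UNIV. if j \<in> pivots then of_int (num (row_of j) (h k)) * ?c (h j) else 0) =
          (\<Sum>j\<in>pivots. of_int (num (row_of j) (h k)) * ?c (s (row_of j)))"
        by (simp add: sum.If_cases s_row_of)
      also have "\<dots> = (\<Sum>i=1..l. of_int (num i (h k)) * ?c (s i))"
        by (rule sum.reindex_bij_betw [OF pivot_bij])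
      finally show ?thesis by (simp add: D_def)
    qed
    have "x \<in> int_lattice \<longleftrightarrow> torus_point d ?c \<in> Lambda_group d v"
      using torus_point_in_Lambda_group_iff [of d v ?c] v by (simp add: sum_uv sum_c)
    also have "\<dots> \<longleftrightarrow> (\<forall>i\<in>{1..l}. real p * ?c (s i) \<in> \<int>) \<and>
        (\<forall>j\<in>{1..d} - S. ?c j - (\<Sum>i=1..l. of_int (num i j) * ?c (s i)) \<in> \<int>)"
      unfolding Lambda using sum_c by (intro gen_group_iff) simp
    also have "(\<forall>i\<in>{1..l}. real p * ?c (s i) \<in> \<int>) \<longleftrightarrow> (\<forall>k. k \<in> pivots \<longrightarrow> real p * ?c (h k) \<in> \<int>)"
    proof -
      have "(\<forall>i\<in>{1..l}. real p * ?c (s i) \<in> \<int>) \<longleftrightarrow> (\<forall>k\<in>pivots. real p * ?c (s (row_of k)) \<in> \<int>)"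
        unfolding bij_betw_imp_surj_on [OF pivot_bij, symmetric] by blast
      then show ?thesis by (simp add: s_row_of Ball_def)
    qed
    also have "(\<forall>j\<in>{1..d} - S. ?c j - (\<Sum>i=1..l. of_int (num i j) * ?c (s i)) \<in> \<int>) \<longleftrightarrow>
        (\<forall>k. k \<notin> pivots \<longrightarrow> ?c (h k) - (\<Sum>i=1..l. of_int (num i (h k)) * ?c (s i)) \<in> \<int>)"
    proof -
      have "{1..d} - S = h ` (- pivots)" using h by (auto simp: pivots_def bij_betw_def)
      then show ?thesis by auto
    qed
    finally show ?thesis unfolding int_lattice_def mem_Collect_eq HU by auto
  qed
  ultimately have "\<bar>det (H ** U)\<bar> = 1" by (rule det_lattice_automorphism)
  then show ?thesis
    using det_H p_pos by (simp add: det_mul abs_mult U_def field_simps)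
qed

section \<open>The volume of the dual polytope\<close>

theorem theorem4p3:
  fixes p d l :: nat
    and s :: "nat \<Rightarrow> nat"
    and a :: "nat \<Rightarrow> nat \<Rightarrow> int"
    and r :: int
    and v :: "nat \<Rightarrow> real ^ 'n"
    and \<Delta> :: "(real ^ 'n) set"
  assumes "prime p"
    and "d > 0" and "l > 0" and "l \<le> d"
    and "1 \<le> s 1" and "strict_mono_on {1..l} s" and "s l = d"
    and "\<And>i j. i \<in> {1..l} \<Longrightarrow> 1 \<le> j \<Longrightarrow> j < s i \<Longrightarrow> j \<notin> s ` {1..<i} \<Longrightarrow>
           1 \<le> a i j \<and> a i j \<le> int p - 1"
    and "int d = r * int p - 1"
    and "\<And>j. 1 \<le> j \<Longrightarrow> j < d \<Longrightarrow> j \<notin> s ` {1..l} \<Longrightarrow>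
           \<exists>t::int. t > 0 \<and> (\<Sum>i | i \<in> {1..l} \<and> j < s i. a i j) = t * int p - 1"
    and "CARD('n) = d"
    and "lattice_polytope \<Delta>" and "simplex_with_vertices d v \<Delta>"
    and "Lambda_group d v = group_closure (gen p d s a ` {1..l})"
  shows "gorenstein_of_index r \<Delta> \<and>
    (\<exists>t. interior ((*\<^sub>R) (of_int r) ` \<Delta>) \<inter> int_lattice = {t} \<and>
         normalized_volume (dual_polytope ((\<lambda>x. of_int r *\<^sub>R x - t) ` \<Delta>)) =
           of_int r * real p ^ (d - l + 1))"
proof -
  have p_pos: "p > 0" using assms(1) by (rule prime_gt_0_nat)
  interpret generator_data p d l s a
    using p_pos assms by unfold_locales auto
  obtain C where C: "\<not> affine_dependent C" "\<Delta> = convex hull C"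
    and dim: "int d simplex \<Delta>" and bij: "bij_betw v {..d} {x. x extreme_point_of \<Delta>}"
    using assms(13) by (auto simp: simplex_with_vertices_def simplex_def atLeast0AtMost)
  then have "{x. x extreme_point_of \<Delta>} = C"
    by (simp add: extreme_point_of_convex_hull_affine_independent)
  then have inj: "inj_on v {..d}" and vC: "v ` {..d} = C" using bij by (auto simp: bij_betw_def)
  then have \<Delta>: "\<Delta> = convex hull (v ` {..d})" and indep: "\<not> affine_dependent (v ` {..d})"
    using C by auto
  have v_int: "v i \<in> int_lattice" if "i \<le> d" for i
    using assms(12) bij that by (auto simp: lattice_polytope_def bij_betw_def)
  obtain u where u: "(\<Sum>i\<le>d. u i) = 0"
    "\<And>i j k. i \<le> d \<Longrightarrow> j \<le> d \<Longrightarrow> k \<le> d \<Longrightarrow>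
       u i \<bullet> (v j - v k) = (if i = j then 1 else 0) - (if i = k then 1 else 0)"
    "\<And>x. (\<Sum>i\<le>d. (u i \<bullet> x) *\<^sub>R v i) = x" "\<And>y. (\<Sum>i\<le>d. (v i \<bullet> y) *\<^sub>R u i) = y"
    using affine_dual_basis [OF assms(11) inj indep] by blast
  define m where "m = (1 / p) *\<^sub>R (\<Sum>i\<le>d. v i)"
  have "torus_point d (\<lambda>_. 1 / real p) \<in> group_closure (gen p d s a ` {1..l})"
  proof (rule barycenter_in_gen_group [OF assms(9)])
    fix j assume "1 \<le> j" "j < d" "j \<notin> S"
    then show "\<exists>t::int. (\<Sum>i | i \<in> {1..l} \<and> j < s i. a i j) = t * int p - 1"
      using assms(10) [of j] unfolding S_def by blast
  qed
  then have m_int: "m \<in> int_lattice"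
    using torus_point_in_Lambda_group_iff [of d v "\<lambda>_. 1 / real p"] v_int
    by (simp add: assms(14) m_def scaleR_sum_right)
  have u_int: "real p * (u i \<bullet> x) \<in> \<int>" if "i \<le> d" "x \<in> int_lattice" for i x
  proof -
    have "(\<Sum>i\<le>d. u i \<bullet> x) = 0" using u(1) by (simp flip: inner_sum_left)
    then have "torus_point d (\<lambda>i. u i \<bullet> x) \<in> Lambda_group d v"
      using torus_point_in_Lambda_group_iff [of d v "\<lambda>i. u i \<bullet> x"] v_int that u(3) by simp
    then show ?thesis using gen_group_denominator that(1) unfolding assms(14) by blast
  qed
  have rp: "of_int r * real p = real d + 1"
    using arg_cong [OF assms(9), of real_of_int] by simp
  interpret barycentric_lattice_simplex d p r v u m
    by unfold_locales (use assms p_pos rp u m_def v_int m_int u_int in auto)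
  obtain h :: "'n \<Rightarrow> nat" where h: "bij_betw h UNIV {1..d}"
    using finite_same_card_bij [of "UNIV :: 'n set" "{1..d}"] assms(11) by auto
  have "aff_dim \<Delta> = int CARD('n)"
    using aff_dim_simplex [OF dim] assms(11) by simp
  then have "gorenstein_of_index r \<Delta>"
    using r_pos assms(12) m_int int_lattice_diff [OF int_lattice_0 m_int] reflexive_translate
    unfolding gorenstein_of_index_def full_dim_lattice_polytope_def \<Delta>
    by (auto intro!: exI [of _ Q] exI [of _ "- m"])
  moreover have "normalized_volume (dual_polytope Q) = of_int r * real p ^ (d - l + 1)"
  proof -
    have "real p ^ d = real p ^ l * real p ^ (d - l)"
      using assms(4) by (simp flip: power_add)
    moreover have "\<bar>det (\<chi> k. u (h k))\<bar> = 1 / real p ^ l"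
      by (rule det_dual_basis [OF h _ u(1) u(3) assms(14)]) (rule v_int)
    ultimately show ?thesis
      using p_pos unfolding volume_dual [OF h] rp [symmetric] by simp
  qed
  ultimately show ?thesis
    using interior_dilate_lattice unfolding \<Delta> by blast
qed

end
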